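(* Let $(A,\mu,\alpha)$ be a multiplicative Hom-Jordan algebra over $\mathbf{k}$, and write $xy=\mu(x,y)$. Then $A_L = (A,[,,],\alpha^2)$ is a multiplicative Hom-Lie triple system (with both twisting maps equal to $\alpha^2$), where $$[xyz] = 2\left(\alpha(x)(yz) - \alpha(y)(xz)\right)$$ for $x,y,z\in A$.
   Context: $\mathbf{k}$ is a fixed field of characteristic $0$; $\alpha^k$ denotes $k$-fold composition. A multiplicative Hom-algebra $(A,\mu,\alpha)$ is a $\mathbf{k}$-module $A$ with a bilinear map $\mu\colon A\otimes A\to A$ (no associativity assumed) and a linear map $\alpha\colon A\to A$ such that $\alpha(\mu(x,y))=\mu(\alpha(x),\alpha(y))$. Its Hom-associator is $as_A(x,y,z) = (xy)\alpha(z) - \alpha(x)(yz)$. A Hom-Jordan algebra is a Hom-algebra $(A,\mu,\alpha)$ such that $\mu$ is commutative ($xy=yx$) and $as_A(x^2,\alpha(y),\alpha(x))=0$ for all $x,y\in A$, where $x^2=\mu(x,x)$. A Hom-Lie triple system $(L,[,,],(\alpha_1,\alpha_2))$ is a $\mathbf{k}$-module $L$ with a trilinear map $[,,]\colon L^{\otimes 3}\to L$ and linear maps $\alpha_1,\alpha_2\colon L\to L$ (the twisting maps) such that, for all $u,v,w,x,y\in L$: $[uvw]=-[vuw]$; $[uvw]+[wuv]+[vwu]=0$; and $$[\alpha_1(x)\,\alpha_2(y)\,[uvw]] = [[xyu]\,\alpha_1(v)\,\alpha_2(w)] + [\alpha_1(u)\,[xyv]\,\alpha_2(w)] + [\alpha_1(u)\,\alpha_2(v)\,[xyw]].$$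 When $\alpha_1=\alpha_2=\gamma$ it is written $(L,[,,],\gamma)$; it is multiplicative if $\alpha_1=\alpha_2=\gamma$ and $\gamma([xyz])=[\gamma(x)\gamma(y)\gamma(z)]$ for all $x,y,z$. *)

theory Defs
  imports Complex_Main
begin

text \<open>
  A module over the ground field is a type \<open>'a\<close> with a scalar multiplication \<open>scale\<close> satisfying
  \<^locale>\<open>vector_space\<close>. Since Isabelle's \<open>linear\<close> on its own refers to real vector spaces,
  the general notion is written \<open>Vector_Spaces.linear\<close>; for a map
  \<open>f\<close>, \<open>Vector_Spaces.linear scale scale f\<close> says that \<open>f\<close> is an endomorphism of the module.
  Linear maps out of tensor powers are rendered as maps that are linear in each argument separately.
\<close>

locale hom_algebra = vector_space scale
  for scale :: "'k::field_char_0 \<Rightarrow> 'a::ab_group_add \<Rightarrow> 'a"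
  + fixes \<mu> :: "'a \<Rightarrow> 'a \<Rightarrow> 'a"
    and \<alpha> :: "'a \<Rightarrow> 'a"
  assumes linear_left: "\<And>y. Vector_Spaces.linear scale scale (\<lambda>x. \<mu> x y)"
    and linear_right: "\<And>x. Vector_Spaces.linear scale scale (\<lambda>y. \<mu> x y)"
    and linear_twist: "Vector_Spaces.linear scale scale \<alpha>"

locale multiplicative_hom_algebra = hom_algebra scale \<mu> \<alpha>
  for scale :: "'k::field_char_0 \<Rightarrow> 'a::ab_group_add \<Rightarrow> 'a"
    and \<mu> :: "'a \<Rightarrow> 'a \<Rightarrow> 'a"
    and \<alpha> :: "'a \<Rightarrow> 'a"
  + assumes twist_mult: "\<And>x y. \<alpha> (\<mu> x y) = \<mu> (\<alpha> x) (\<alpha> y)"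

definition hom_associator ::
  "('a::ab_group_add \<Rightarrow> 'a \<Rightarrow> 'a) \<Rightarrow> ('a \<Rightarrow> 'a) \<Rightarrow> 'a \<Rightarrow> 'a \<Rightarrow> 'a \<Rightarrow> 'a" where
  "hom_associator \<mu> \<alpha> x y z = \<mu> (\<mu> x y) (\<alpha> z) - \<mu> (\<alpha> x) (\<mu> y z)"

locale hom_jordan_algebra = hom_algebra scale \<mu> \<alpha>
  for scale :: "'k::field_char_0 \<Rightarrow> 'a::ab_group_add \<Rightarrow> 'a"
    and \<mu> :: "'a \<Rightarrow> 'a \<Rightarrow> 'a"
    and \<alpha> :: "'a \<Rightarrow> 'a"
  + assumes mult_commute: "\<And>x y. \<mu> x y = \<mu> y x"
    and hom_jordan_identity: "\<And>x y. hom_associator \<mu> \<alpha> (\<mu> x x) (\<alpha> y) (\<alpha> x) = 0"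

locale multiplicative_hom_jordan_algebra =
  multiplicative_hom_algebra scale \<mu> \<alpha> + hom_jordan_algebra scale \<mu> \<alpha>
  for scale :: "'k::field_char_0 \<Rightarrow> 'a::ab_group_add \<Rightarrow> 'a"
    and \<mu> :: "'a \<Rightarrow> 'a \<Rightarrow> 'a"
    and \<alpha> :: "'a \<Rightarrow> 'a"

locale hom_lie_triple_system = vector_space scale
  for scale :: "'k::field_char_0 \<Rightarrow> 'a::ab_group_add \<Rightarrow> 'a"
  + fixes br :: "'a \<Rightarrow> 'a \<Rightarrow> 'a \<Rightarrow> 'a"
    and \<alpha>1 \<alpha>2 :: "'a \<Rightarrow> 'a"
  assumes linear_arg1: "\<And>y z. Vector_Spaces.linear scale scale (\<lambda>x. br x y z)"
    and linear_arg2: "\<And>x z. Vector_Spaces.linear scale scale (\<lambda>y. br x y z)"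
    and linear_arg3: "\<And>x y. Vector_Spaces.linear scale scale (\<lambda>z. br x y z)"
    and linear_twist1: "Vector_Spaces.linear scale scale \<alpha>1"
    and linear_twist2: "Vector_Spaces.linear scale scale \<alpha>2"
    and left_skew: "\<And>u v w. br u v w = - br v u w"
    and cyclic: "\<And>u v w. br u v w + br w u v + br v w u = 0"
    and hom_nambu: "\<And>u v w x y. br (\<alpha>1 x) (\<alpha>2 y) (br u v w) =
      br (br x y u) (\<alpha>1 v) (\<alpha>2 w) + br (\<alpha>1 u) (br x y v) (\<alpha>2 w) + br (\<alpha>1 u) (\<alpha>2 v) (br x y w)"

locale multiplicative_hom_lie_triple_system = hom_lie_triple_system scale br \<gamma> \<gamma>
  for scale :: "'k::field_char_0 \<Rightarrow> 'a::ab_group_add \<Rightarrow> 'a"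
    and br :: "'a \<Rightarrow> 'a \<Rightarrow> 'a \<Rightarrow> 'a"
    and \<gamma> :: "'a \<Rightarrow> 'a"
  + assumes twist_bracket: "\<And>x y z. \<gamma> (br x y z) = br (\<gamma> x) (\<gamma> y) (\<gamma> z)"

end

theory Submission
  imports Defs
begin

text \<open>
  Write \<open>D\<^bsub>x,y\<^esub>(z) = \<alpha>(x)(yz) - \<alpha>(y)(xz)\<close>, so that the bracket is \<open>2 D\<^bsub>x,y\<^esub>(z)\<close>. As in an
  ordinary Jordan algebra, the reason for the Nambu identity is that \<open>D\<^bsub>x,y\<^esub>\<close> is a derivation, up to
  twisting:
  \<open>D\<^bsub>\<alpha>(x),\<alpha>(y)\<^esub>(uv) = D\<^bsub>x,y\<^esub>(u) \<alpha>\<^sup>2(v) + \<alpha>\<^sup>2(u) D\<^bsub>x,y\<^esub>(v)\<close>.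

  To see this, polarize the Hom-Jordan identity, which is cubic in \<open>x\<close>, to
  \<open>\<Sum> ((ab)\<alpha>(y))\<alpha>\<^sup>2(c) = \<Sum> \<alpha>(ab)\<alpha>(yc)\<close>,
  with both sums over the cyclic permutations of \<open>a\<close>, \<open>b\<close>, \<open>c\<close>. The right-hand
  side is the sum over the three ways of splitting \<open>{a, b, c, y}\<close> into two pairs, so it is symmetric in all four variables, \<open>y\<close> included. Hence the left-hand side does not change when
  \<open>c\<close> and \<open>y\<close> are exchanged, and this is the derivation rule for \<open>D\<^bsub>c,y\<^esub>\<close> on \<open>ab\<close>. In all these
  quartic products a factor at depth \<open>d\<close> carries the twist \<open>\<alpha>\<^bsup>3-d\<^esup>\<close>, whatever the bracketing; this
  is why the classical computation goes through with the twists put in.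

  Applying the derivation rule twice to \<open>\<alpha>(u)(vw) - \<alpha>(v)(uw)\<close>, once to the outer and once to the
  inner product, gives the Nambu identity.
\<close>

text \<open>
  Expand \<open>f\<close> on the diagonal at \<open>a + b + c\<close>: the terms with at most two distinct arguments sum
  to zero, as the expansions at \<open>a + b\<close>, \<open>a + c\<close> and \<open>b + c\<close> show.
\<close>

lemma polarize_cubic:
  fixes f :: "'a::ab_group_add \<Rightarrow> 'a \<Rightarrow> 'a \<Rightarrow> 'b::ab_group_add"
  assumes add1: "\<And>x x' y z. f (x + x') y z = f x y z + f x' y z"
    and add2: "\<And>x y y' z. f x (y + y') z = f x y z + f x y' z"
    and add3: "\<And>x y z z'. f x y (z + z') = f x y z + f x y z'"
    and diag: "\<And>x. f x x x = 0"
  shows "f a b c + f a c b + f b a c + f b c a + f c a b + f c b a = 0"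
proof -
  have pair: "f x x y + f x y x + f y x x + (f x y y + f y x y + f y y x) = 0" for x y
    using diag[of "x + y", unfolded add1 add2 add3] by (simp add: diag add_ac)
  have "f a b c + f a c b + f b a c + f b c a + f c a b + f c b a
     + (f a a b + f a b a + f b a a + (f a b b + f b a b + f b b a))
     + (f a a c + f a c a + f c a a + (f a c c + f c a c + f c c a))
     + (f b b c + f b c b + f c b b + (f b c c + f c b c + f c c b)) = 0"
    using diag[of "a + b + c", unfolded add1 add2 add3] by (simp add: diag add_ac)
  then show ?thesis by (simp only: pair add_0_right)
qed

context hom_algebra
begin

lemma mult_add_left: "\<mu> (x + x') y = \<mu> x y + \<mu> x' y"
  and mult_scale_left: "\<mu> (scale c x) y = scale c (\<mu> x y)"
  using linear_left[of y] by (auto simp: Vector_Spaces.linear_iff)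

lemma mult_add_right: "\<mu> x (y + y') = \<mu> x y + \<mu> x y'"
  and mult_scale_right: "\<mu> x (scale c y) = scale c (\<mu> x y)"
  using linear_right[of x] by (auto simp: Vector_Spaces.linear_iff)

lemma twist_add: "\<alpha> (x + y) = \<alpha> x + \<alpha> y"
  and twist_scale: "\<alpha> (scale c x) = scale c (\<alpha> x)"
  using linear_twist by (auto simp: Vector_Spaces.linear_iff)

lemma mult_diff_left: "\<mu> (x - x') y = \<mu> x y - \<mu> x' y"
  using mult_add_left[of "x - x'" x' y] by (simp add: algebra_simps)

lemma mult_diff_right: "\<mu> x (y - y') = \<mu> x y - \<mu> x y'"
  using mult_add_right[of x "y - y'" y'] by (simp add: algebra_simps)

lemma twist_diff: "\<alpha> (x - y) = \<alpha> x - \<alpha> y"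
  using twist_add[of "x - y" y] by (simp add: algebra_simps)

lemma double_eq_zeroD:
  assumes "v + v = (0::'a)"
  shows "v = 0"
proof -
  have "scale 2 v = v + v"
    using scale_left_distrib[of 1 1 v] by simp
  with assms show ?thesis by simp
qed

text \<open>
  This is \<open>D\<^bsub>x,y\<^esub>(z)\<close>; for \<open>\<alpha> = id\<close> it is the commutator of the left multiplications by \<open>x\<close> and \<open>y\<close>,
  applied to \<open>z\<close>.
\<close>

definition commutator :: "'a \<Rightarrow> 'a \<Rightarrow> 'a \<Rightarrow> 'a" where
  "commutator x y z = \<mu> (\<alpha> x) (\<mu> y z) - \<mu> (\<alpha> y) (\<mu> x z)"

lemma commutator_scale:
  "commutator (scale c x) y z = scale c (commutator x y z)"
  "commutator x (scale c y) z = scale c (commutator x y z)"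
  "commutator x y (scale c z) = scale c (commutator x y z)"
  by (simp_all add: commutator_def mult_scale_left mult_scale_right twist_scale
      scale_right_diff_distrib)

lemma commutator_add:
  "commutator (x + x') y z = commutator x y z + commutator x' y z"
  "commutator x (y + y') z = commutator x y z + commutator x y' z"
  "commutator x y (z + z') = commutator x y z + commutator x y z'"
  by (simp_all add: commutator_def mult_add_left mult_add_right twist_add)

lemma commutator_diff_right:
  "commutator x y (z - z') = commutator x y z - commutator x y z'"
  by (simp add: commutator_def mult_diff_right)

lemma commutator_swap: "commutator x y z = - commutator y x z"
  by (simp add: commutator_def)

end

context multiplicative_hom_jordan_algebra
begin

lemma twist_commutator: "\<alpha> (commutator x y z) = commutator (\<alpha> x) (\<alpha> y) (\<alpha> z)"
  by (simp add: commutator_def twist_diff twist_mult)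

lemma commutator_cyclic: "commutator u v w + commutator w u v + commutator v w u = 0"
  by (simp add: commutator_def mult_commute[of v u] mult_commute[of w u] mult_commute[of w v])

text \<open>
  Polarization sums over all six orderings of \<open>a\<close>, \<open>b\<close>, \<open>c\<close>; commutativity identifies them in pairs,
  and the resulting factor 2 is cancelled in characteristic 0.
\<close>

lemma hom_jordan_identity_linearized:
  "\<mu> (\<mu> (\<mu> a b) (\<alpha> y)) (\<alpha> (\<alpha> c)) + \<mu> (\<mu> (\<mu> b c) (\<alpha> y)) (\<alpha> (\<alpha> a))
      + \<mu> (\<mu> (\<mu> c a) (\<alpha> y)) (\<alpha> (\<alpha> b))
   = \<mu> (\<alpha> (\<mu> a b)) (\<alpha> (\<mu> y c)) + \<mu> (\<alpha> (\<mu> b c)) (\<alpha> (\<mu> y a))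
      + \<mu> (\<alpha> (\<mu> c a)) (\<alpha> (\<mu> y b))"
proof -
  define f where "f = (\<lambda>a b c. hom_associator \<mu> \<alpha> (\<mu> a b) (\<alpha> y) (\<alpha> c))"
  have "f a b c + f a c b + f b a c + f b c a + f c a b + f c b a = 0"
    by (rule polarize_cubic)
      (simp_all add: f_def hom_associator_def mult_add_left mult_add_right twist_add
        hom_jordan_identity[unfolded hom_associator_def])
  moreover have "f x z w = f z x w" for x z w
    by (simp add: f_def mult_commute[of x z])
  ultimately have "(f a b c + f b c a + f c a b) + (f a b c + f b c a + f c a b) = 0"
    by (simp add: add_ac)
  then have "f a b c + f b c a + f c a b = 0"
    by (rule double_eq_zeroD)
  then show ?thesis
    by (simp add: f_def hom_associator_def twist_mult algebra_simps)
qed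

text \<open>
  Exchanging \<open>x\<close> and \<open>y\<close> in the linearized identity for \<open>u, v, x; y\<close> permutes the three pairings of
  \<open>{u, v, x, y}\<close> on its right-hand side, so the two left-hand sides agree; their difference is the
  derivation rule.
\<close>

lemma commutator_derivation:
  "commutator (\<alpha> x) (\<alpha> y) (\<mu> u v)
   = \<mu> (commutator x y u) (\<alpha> (\<alpha> v)) + \<mu> (\<alpha> (\<alpha> u)) (commutator x y v)"
proof -
  define pairings where "pairings = \<mu> (\<alpha> (\<mu> u v)) (\<alpha> (\<mu> x y))
      + \<mu> (\<alpha> (\<mu> u x)) (\<alpha> (\<mu> v y)) + \<mu> (\<alpha> (\<mu> v x)) (\<alpha> (\<mu> u y))"
  have "\<mu> (\<alpha> (\<alpha> x)) (\<mu> (\<alpha> y) (\<mu> u v)) + \<mu> (\<alpha> (\<alpha> u)) (\<mu> (\<alpha> y) (\<mu> x v))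
      + \<mu> (\<mu> (\<alpha> y) (\<mu> x u)) (\<alpha> (\<alpha> v)) = pairings"
    using hom_jordan_identity_linearized[of u v y x]
    by (simp add: pairings_def mult_commute add_ac)
  moreover have "\<mu> (\<alpha> (\<alpha> y)) (\<mu> (\<alpha> x) (\<mu> u v)) + \<mu> (\<alpha> (\<alpha> u)) (\<mu> (\<alpha> x) (\<mu> y v))
      + \<mu> (\<mu> (\<alpha> x) (\<mu> y u)) (\<alpha> (\<alpha> v)) = pairings"
    using hom_jordan_identity_linearized[of u v x y]
    by (simp add: pairings_def mult_commute add_ac)
  ultimately show ?thesis
    by (simp add: commutator_def mult_diff_left mult_diff_right algebra_simps)
qed

text \<open>
  Expanding by the derivation rule gives six terms, three from \<open>\<alpha>(u)(vw)\<close> and three from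
  \<open>\<alpha>(v)(uw)\<close>; grouped by whether \<open>u\<close>, \<open>v\<close> or \<open>w\<close> is differentiated, they are the three summands.
\<close>

lemma commutator_nambu:
  "commutator (\<alpha> (\<alpha> x)) (\<alpha> (\<alpha> y)) (commutator u v w)
   = commutator (commutator x y u) (\<alpha> (\<alpha> v)) (\<alpha> (\<alpha> w))
   + commutator (\<alpha> (\<alpha> u)) (commutator x y v) (\<alpha> (\<alpha> w))
   + commutator (\<alpha> (\<alpha> u)) (\<alpha> (\<alpha> v)) (commutator x y w)"
proof -
  \<comment> \<open>The derivation rule is used on the outer product, with \<open>\<alpha> x\<close> and \<open>\<alpha> y\<close> for \<open>x\<close> and \<open>y\<close>, and then on
    \<open>\<mu> q w\<close>; multiplicativity turns \<open>commutator (\<alpha> x) (\<alpha> y) (\<alpha> p)\<close> into \<open>\<alpha> (commutator x y p)\<close>.\<close>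
  have nested: "commutator (\<alpha> (\<alpha> x)) (\<alpha> (\<alpha> y)) (\<mu> (\<alpha> p) (\<mu> q w))
      = \<mu> (\<alpha> (commutator x y p)) (\<mu> (\<alpha> (\<alpha> q)) (\<alpha> (\<alpha> w)))
      + \<mu> (\<alpha> (\<alpha> (\<alpha> p))) (\<mu> (commutator x y q) (\<alpha> (\<alpha> w)))
      + \<mu> (\<alpha> (\<alpha> (\<alpha> p))) (\<mu> (\<alpha> (\<alpha> q)) (commutator x y w))" for p q
    by (simp add: commutator_derivation twist_commutator twist_mult mult_add_right add_ac)
  have "commutator (\<alpha> (\<alpha> x)) (\<alpha> (\<alpha> y)) (commutator u v w)
      = commutator (\<alpha> (\<alpha> x)) (\<alpha> (\<alpha> y)) (\<mu> (\<alpha> u) (\<mu> v w))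
      - commutator (\<alpha> (\<alpha> x)) (\<alpha> (\<alpha> y)) (\<mu> (\<alpha> v) (\<mu> u w))"
    by (simp only: commutator_def[of u v w] commutator_diff_right)
  also have "\<dots> = commutator (commutator x y u) (\<alpha> (\<alpha> v)) (\<alpha> (\<alpha> w))
   + commutator (\<alpha> (\<alpha> u)) (commutator x y v) (\<alpha> (\<alpha> w))
   + commutator (\<alpha> (\<alpha> u)) (\<alpha> (\<alpha> v)) (commutator x y w)"
    unfolding nested
      commutator_def[of "commutator x y u"] commutator_def[of "\<alpha> (\<alpha> u)" "commutator x y v"]
      commutator_def[of "\<alpha> (\<alpha> u)" "\<alpha> (\<alpha> v)"]
    by (simp add: algebra_simps)
  finally show ?thesis .
qed

end

theorem corollary4p1:
  fixes scale :: "'k::field_char_0 \<Rightarrow> 'a::ab_group_add \<Rightarrow> 'a"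
    and \<mu> :: "'a \<Rightarrow> 'a \<Rightarrow> 'a"
    and \<alpha> :: "'a \<Rightarrow> 'a"
  assumes "multiplicative_hom_jordan_algebra scale \<mu> \<alpha>"
  shows "multiplicative_hom_lie_triple_system scale
    (\<lambda>x y z. scale 2 (\<mu> (\<alpha> x) (\<mu> y z) - \<mu> (\<alpha> y) (\<mu> x z))) (\<alpha> ^^ 2)"
proof -
  interpret multiplicative_hom_jordan_algebra scale \<mu> \<alpha> by (fact assms)
  have twist2: "\<alpha> ^^ 2 = (\<lambda>x. \<alpha> (\<alpha> x))"
    by (simp add: numeral_2_eq_2 fun_eq_iff)
  let ?br = "\<lambda>x y z. scale 2 (commutator x y z)"
  have br_linear1: "Vector_Spaces.linear scale scale (\<lambda>x. ?br x y z)" for y z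
    by (simp add: Vector_Spaces.linear_iff vector_space_axioms commutator_add
        commutator_scale(1) scale_right_distrib mult.commute)
  have br_linear2: "Vector_Spaces.linear scale scale (\<lambda>y. ?br x y z)" for x z
    by (simp add: Vector_Spaces.linear_iff vector_space_axioms commutator_add
        commutator_scale(2) scale_right_distrib mult.commute)
  have br_linear3: "Vector_Spaces.linear scale scale (\<lambda>z. ?br x y z)" for x y
    by (simp add: Vector_Spaces.linear_iff vector_space_axioms commutator_add
        commutator_scale(3) scale_right_distrib mult.commute)
  have twist2_linear: "Vector_Spaces.linear scale scale (\<lambda>x. \<alpha> (\<alpha> x))"
    by (simp add: Vector_Spaces.linear_iff vector_space_axioms twist_add twist_scale)
  have br_skew: "?br u v w = - ?br v u w" for u v w
    using commutator_swap[of u v w] by simp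
  have br_cyclic: "?br u v w + ?br w u v + ?br v w u = 0" for u v w
    by (simp only: scale_right_distrib[symmetric] commutator_cyclic scale_zero_right)
  \<comment> \<open>Each side is quadratic in the bracket, so the same factor 4 comes out of every term.\<close>
  have br_nambu: "?br (\<alpha> (\<alpha> x)) (\<alpha> (\<alpha> y)) (?br u v w) =
      ?br (?br x y u) (\<alpha> (\<alpha> v)) (\<alpha> (\<alpha> w)) + ?br (\<alpha> (\<alpha> u)) (?br x y v) (\<alpha> (\<alpha> w))
      + ?br (\<alpha> (\<alpha> u)) (\<alpha> (\<alpha> v)) (?br x y w)" for u v w x y
    by (simp only: commutator_scale commutator_nambu[of x y u v w] scale_right_distrib)
  have twist2_br: "\<alpha> (\<alpha> (?br x y z)) = ?br (\<alpha> (\<alpha> x)) (\<alpha> (\<alpha> y)) (\<alpha> (\<alpha> z))" for x y z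
    by (simp only: twist_scale twist_commutator)
  have "hom_lie_triple_system scale ?br (\<lambda>x. \<alpha> (\<alpha> x)) (\<lambda>x. \<alpha> (\<alpha> x))"
    by (intro hom_lie_triple_system.intro hom_lie_triple_system_axioms.intro vector_space_axioms
        br_linear1 br_linear2 br_linear3 twist2_linear br_skew br_cyclic br_nambu)
  then have "multiplicative_hom_lie_triple_system scale ?br (\<lambda>x. \<alpha> (\<alpha> x))"
    by (intro multiplicative_hom_lie_triple_system.intro
        multiplicative_hom_lie_triple_system_axioms.intro twist2_br)
  then show ?thesis
    unfolding commutator_def twist2 .
qed

end
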